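(* Let $w_0\in(0,1)$ and $s_1,s_2,s_4,s_5\in(0,2)$. The D2Q5 MRT-LB model for the diffusion equation with constant source $R$ is equivalent to a six-level finite-difference scheme in the following sense: for every evolution $(f_i)_{i=0}^4$ of the MRT-LB model on the lattice, with arbitrary initial data at time level $0$, the macroscopic variable $\phi=\sum_{i=0}^4f_i+\frac{\Delta t}{2}R$ satisfies, for all $n\ge4$ and all $i,j\in\mathbb Z$, $$\begin{aligned}\phi_{i,j}^{n+1}=&\ \alpha_1\phi^n_{i,j}+\alpha_2\,\Sigma_1\phi^n_{i,j}+\beta_1\phi^{n-1}_{i,j}+\beta_2\,\Sigma_1\phi^{n-1}_{i,j}+\beta_3\,\Sigma_2\phi^{n-1}_{i,j}+\gamma_1\phi^{n-2}_{i,j}+\gamma_2\,\Sigma_1\phi^{n-2}_{i,j}+\gamma_3\,\Sigma_2\phi^{n-2}_{i,j}\\&+\zeta_1\phi^{n-3}_{i,j}+\zeta_2\,\Sigma_1\phi^{n-3}_{i,j}+\eta\,\phi^{n-4}_{i,j}+\Delta t\,\delta R,\end{aligned}$$ where $$\begin{aligned} &\alpha_1=(w_0-1)s_4+1,\quad \alpha_2=1-\tfrac{s_5}{4}-\tfrac{s_2}{2}-\tfrac{s_4w_0}{4},\quad \beta_1=(s_4w_0+s_5-2)(1-s_2),\\ &\beta_2=\tfrac{(s_5+2s_2-4)(1-s_4)+w_0s_4(s_5+2s_2-3)}{4},\quad \beta_3=\tfrac{(2-s_2-s_4w_0)(s_2+s_5-2)}{4},\\ &\gamma_1=s_4w_0(s_2-1)(s_5-1)+(1-s_4)(s_5-2)(s_2-1),\\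 &\gamma_2=\tfrac{(s_2-1)\left(s_4w_0(3-s_2-2s_5)+(2s_2+3s_5-s_2s_5-4)\right)}{4},\\ &\gamma_3=\tfrac{w_0s_4(s_2-1)(s_2+s_5-2)+(1-s_4)(s_2-2)(s_2+s_5-2)}{4},\\ &\zeta_1=(w_0s_4-1)(1-s_5)(s_2-1)^2,\\ &\zeta_2=\tfrac{s_4w_0(s_2-1)^2(s_5-1)+(1-s_4)(1-s_2)(2s_2+3s_5-s_2s_5-4)}{4},\\ &\eta=(1-s_2)^2(1-s_4)(1-s_5),\quad \delta=s_2^2s_4s_5. \end{aligned}$$
   Context: **Setting.** The equation is $\partial_t\phi=\nabla\cdot(\kappa\nabla\phi)+R$ in two space dimensions with constants $\kappa$ and $R$. The lattice is $\Delta x\,\mathbb Z\times\Delta x\,\mathbb Z$, times are $t_n=n\Delta t$, $c=\Delta x/\Delta t$, and $\phi^n_{i,j}=\phi(i\Delta x,j\Delta x,t_n)$. **MRT-LB model (D2Q5).** The discrete velocities are $\mathbf c_0=c(0,0)$, $\mathbf c_1=c(1,0)$, $\mathbf c_2=c(0,1)$, $\mathbf c_3=c(-1,0)$, $\mathbf c_4=c(0,-1)$. The distribution functions $f_i$ ($i=0,\dots,4$) evolve by $$f_i(\mathbf r+\mathbf c_i\Delta t,t+\Delta t)=f_i(\mathbf r,t)-\sum_k(M^{-1}SM)_{ik}\,[f_k-f_k^{eq}](\mathbf r,t)+\Delta t\sum_k\big[M^{-1}(I-\tfrac S2)M\big]_{ik}R_k,$$ with $f^{eq}_i=w_i\phi$,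 $R_i=w_iR$, $w_1=w_2=w_3=w_4=(1-w_0)/4$, $\phi=\sum_i f_i+\frac{\Delta t}{2}R$, $S=\mathrm{diag}(s_1,s_2,s_2,s_4,s_5)$, and $$M=\begin{pmatrix}1&1&1&1&1\\0&c&0&-c&0\\0&0&c&0&-c\\-4c^2&c^2&c^2&c^2&c^2\\0&c^2&-c^2&c^2&-c^2\end{pmatrix}.$$ **Notation.** $\Sigma_1\phi_{i,j}=\phi_{i-1,j}+\phi_{i+1,j}+\phi_{i,j-1}+\phi_{i,j+1}$ and $\Sigma_2\phi_{i,j}=\phi_{i-1,j-1}+\phi_{i-1,j+1}+\phi_{i+1,j-1}+\phi_{i+1,j+1}$. *)

theory Defs
  imports "HOL-Analysis.Analysis"
begin

text \<open>
  Vectors and matrices over the numeral type \<open>5\<close> are indexed by its elements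
  \<open>0, 1, 2, 3, 4\<close> (so that \<open>5 = 0\<close> in this type), matching the indices of \<open>f\<^sub>0, \<dots>, f\<^sub>4\<close>.
\<close>

definition vec5 :: "'a \<Rightarrow> 'a \<Rightarrow> 'a \<Rightarrow> 'a \<Rightarrow> 'a \<Rightarrow> 'a ^ 5" where
  "vec5 a0 a1 a2 a3 a4 =
     (\<chi> k. if k = 0 then a0 else if k = 1 then a1 else if k = 2 then a2
          else if k = 3 then a3 else a4)"

lemma vec5_nth [simp]:
  "vec5 a0 a1 a2 a3 a4 $ 0 = a0"
  "vec5 a0 a1 a2 a3 a4 $ 1 = a1"
  "vec5 a0 a1 a2 a3 a4 $ 2 = a2"
  "vec5 a0 a1 a2 a3 a4 $ 3 = a3"
  "vec5 a0 a1 a2 a3 a4 $ 4 = a4"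
  by (simp_all add: vec5_def)

definition diag5 :: "real ^ 5 \<Rightarrow> real ^ 5 ^ 5" where
  "diag5 d = (\<chi> i j. if i = j then d $ i else 0)"

definition d2q5_velocity :: "real \<Rightarrow> (real \<times> real) ^ 5" where
  "d2q5_velocity c = vec5 (0, 0) (c, 0) (0, c) (- c, 0) (0, - c)"

definition d2q5_weight :: "real \<Rightarrow> real ^ 5" where
  "d2q5_weight w0 = vec5 w0 ((1 - w0) / 4) ((1 - w0) / 4) ((1 - w0) / 4) ((1 - w0) / 4)"

definition d2q5_M :: "real \<Rightarrow> real ^ 5 ^ 5" where
  "d2q5_M c = vec5
     (vec5 1 1 1 1 1)
     (vec5 0 c 0 (- c) 0)
     (vec5 0 0 c 0 (- c))
     (vec5 (- 4 * c\<^sup>2) (c\<^sup>2) (c\<^sup>2) (c\<^sup>2) (c\<^sup>2))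
     (vec5 0 (c\<^sup>2) (- (c\<^sup>2)) (c\<^sup>2) (- (c\<^sup>2)))"

definition d2q5_S :: "real \<Rightarrow> real \<Rightarrow> real \<Rightarrow> real \<Rightarrow> real ^ 5 ^ 5" where
  "d2q5_S s1 s2 s4 s5 = diag5 (vec5 s1 s2 s2 s4 s5)"

definition lattice_points :: "real \<Rightarrow> (real \<times> real) set" where
  "lattice_points dx = {(of_int i * dx, of_int j * dx) | i j :: int. True}"

definition macro :: "real \<Rightarrow> real \<Rightarrow> (real \<times> real \<Rightarrow> real \<Rightarrow> real ^ 5) \<Rightarrow> real \<times> real \<Rightarrow> real \<Rightarrow> real" where
  "macro dt R f r t = (\<Sum>k\<in>UNIV. f r t $ k) + dt / 2 * R"

text \<open>
  \<open>f r t $ i\<close> is the distribution function \<open>f\<^sub>i(r, t)\<close>. It is constrained only at the points of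
  the lattice and the times \<open>n \<Delta>t\<close> with \<open>n \<ge> 0\<close>; its values at time \<open>0\<close> are arbitrary.
\<close>

definition mrt_lb_evolution ::
  "real \<Rightarrow> real \<Rightarrow> real \<Rightarrow> real \<Rightarrow> real \<Rightarrow> real \<Rightarrow> real \<Rightarrow> real \<Rightarrow>
   (real \<times> real \<Rightarrow> real \<Rightarrow> real ^ 5) \<Rightarrow> bool" where
  "mrt_lb_evolution dx dt R w0 s1 s2 s4 s5 f \<longleftrightarrow>
     (let c = dx / dt; M = d2q5_M c; S = d2q5_S s1 s2 s4 s5; w = d2q5_weight w0;
          feq = (\<lambda>r t. macro dt R f r t *\<^sub>R w);
          Rvec = R *\<^sub>R w
      in \<forall>r \<in> lattice_points dx. \<forall>n :: nat. \<forall>i.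
           let t = real n * dt in
           f (r + dt *\<^sub>R (d2q5_velocity c $ i)) (t + dt) $ i =
             f r t $ i
             - (\<Sum>k\<in>UNIV. (matrix_inv M ** S ** M) $ i $ k * (f r t - feq r t) $ k)
             + dt * (\<Sum>k\<in>UNIV. (matrix_inv M ** (mat 1 - (1 / 2) *\<^sub>R S) ** M) $ i $ k * Rvec $ k))"

definition macro_grid ::
  "real \<Rightarrow> real \<Rightarrow> real \<Rightarrow> (real \<times> real \<Rightarrow> real \<Rightarrow> real ^ 5) \<Rightarrow> nat \<Rightarrow> int \<Rightarrow> int \<Rightarrow> real" where
  "macro_grid dx dt R f n i j = macro dt R f (of_int i * dx, of_int j * dx) (real n * dt)"

definition Sigma1 :: "(int \<Rightarrow> int \<Rightarrow> real) \<Rightarrow> int \<Rightarrow> int \<Rightarrow> real" where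
  "Sigma1 u i j = u (i - 1) j + u (i + 1) j + u i (j - 1) + u i (j + 1)"

definition Sigma2 :: "(int \<Rightarrow> int \<Rightarrow> real) \<Rightarrow> int \<Rightarrow> int \<Rightarrow> real" where
  "Sigma2 u i j = u (i - 1) (j - 1) + u (i - 1) (j + 1) + u (i + 1) (j - 1) + u (i + 1) (j + 1)"

end

theory Submission
  imports Defs
begin

text \<open>
  The scheme is the result of eliminating all moments but \<open>\<phi>\<close> from the lattice Boltzmann recursion.
  It is a relation of degree five in the time shift \<open>z\<close>, as the Cayley-Hamilton theorem predicts
  for five populations, and the lattice symmetries let it be reached without a determinant.

  Passing to \<open>g = f + (\<Delta>t/2) R w\<close> turns \<open>\<phi>\<close> into \<open>\<Sum> g\<^sub>k\<close> and the source into a constant term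
  (\<open>mrt_post_moments\<close>). Write \<open>a = 1 - s\<^sub>2\<close>, \<open>b = 1 - s\<^sub>5\<close>, \<open>d = 1 - s\<^sub>4\<close>. The rest population
  does not move, and its collision is scalar:
  \<open>z g\<^sub>0 = d g\<^sub>0 + s\<^sub>4 w\<^sub>0 \<phi> + w\<^sub>0 \<Delta>t R\<close>. Conservation of mass leaves
  \<open>q = \<phi> + \<Delta>t R - z g\<^sub>0\<close> for the four moving populations after collision; it is divided among the two
  axes according to \<open>p = (g\<^sub>1 + g\<^sub>3) - (g\<^sub>2 + g\<^sub>4)\<close>, which relaxes to \<open>b p\<close>.

  The momenta disappear first. On each axis, two opposite populations behave like a telegraph
  equation: their sum satisfies a second-order recursion of its own (\<open>opposite_pair\<close>). With
  \<open>\<sigma> = \<phi> - g\<^sub>0\<close>, with \<open>E\<^sub>x\<close> for the sum of the two neighbours along the x axis, and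
  \<open>F\<^sub>x = z\<^sup>2 - a z E\<^sub>x / 2\<close>, \<open>G\<^sub>x = z E\<^sub>x / 2 - a\<close>, \<open>H\<^sub>x = F\<^sub>x - b G\<^sub>x\<close>, and similarly for y, the
  recursions are
  \<open>F\<^sub>x \<sigma> - G\<^sub>x q = - H\<^sub>x p\<close> and \<open>F\<^sub>y \<sigma> - G\<^sub>y q = H\<^sub>y p\<close>.
  All these operators commute, so applying \<open>H\<^sub>y\<close> to the first, \<open>H\<^sub>x\<close> to the second and adding
  removes \<open>p\<close> (\<open>eliminate_anisotropy\<close>). The result is symmetric in x and y and of
  degree at most one in each of \<open>E\<^sub>x\<close> and \<open>E\<^sub>y\<close>, hence only involves \<open>\<Sigma>\<^sub>1 = E\<^sub>x + E\<^sub>y\<close> and \<open>\<Sigma>\<^sub>2 = E\<^sub>x E\<^sub>y\<close>. Finally \<open>z - d\<close> sends \<open>\<sigma>\<close> and \<open>q\<close> to combinations of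
  \<open>\<phi>\<close> and constants (\<open>eliminate_rest_population\<close>), which raises the degree in \<open>z\<close> from four to five.
\<close>

section \<open>Vectors with five components\<close>

lemma UNIV_5: "(UNIV :: 5 set) = {0, 1, 2, 3, 4}"
proof -
  have "card {0, 1, 2, 3, 4 :: 5} = 5" by simp
  then show ?thesis
    by (intro card_subset_eq[symmetric]) simp_all
qed

lemma sum_5: "(\<Sum>k\<in>UNIV. h k) = h (0 :: 5) + h 1 + h 2 + h 3 + h 4"
  for h :: "5 \<Rightarrow> real"
  unfolding UNIV_5 by (simp add: add.assoc)

lemma forall_5: "(\<forall>k :: 5. P k) \<longleftrightarrow> P 0 \<and> P 1 \<and> P 2 \<and> P 3 \<and> P 4"
proof -
  have "(\<forall>k :: 5. P k) \<longleftrightarrow> (\<forall>k \<in> {0, 1, 2, 3, 4 :: 5}. P k)"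
    by (simp only: UNIV_5[symmetric] ball_UNIV)
  then show ?thesis by simp
qed

section \<open>Collision in moment space\<close>

lemma d2q5_M_mult:
  "(d2q5_M c *v v) $ 0 = v $ 0 + v $ 1 + v $ 2 + v $ 3 + v $ 4"
  "(d2q5_M c *v v) $ 1 = c * (v $ 1 - v $ 3)"
  "(d2q5_M c *v v) $ 2 = c * (v $ 2 - v $ 4)"
  "(d2q5_M c *v v) $ 3 = c\<^sup>2 * (v $ 1 + v $ 2 + v $ 3 + v $ 4 - 4 * v $ 0)"
  "(d2q5_M c *v v) $ 4 = c\<^sup>2 * (v $ 1 - v $ 2 + v $ 3 - v $ 4)"
  by (simp_all add: d2q5_M_def matrix_vector_mult_def sum_5 algebra_simps)

lemma d2q5_M_invertible:
  assumes "c \<noteq> 0"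
  shows "invertible (d2q5_M c)"
proof -
  have "v = 0" if "d2q5_M c *v v = 0" for v
  proof -
    have *: "(d2q5_M c *v v) $ k = 0" for k
      using that by simp
    have "v $ 0 + v $ 1 + v $ 2 + v $ 3 + v $ 4 = 0" "v $ 1 = v $ 3" "v $ 2 = v $ 4"
      "v $ 1 + v $ 2 + v $ 3 + v $ 4 = 4 * v $ 0" "v $ 1 - v $ 2 + v $ 3 - v $ 4 = 0"
      using *[of 0] *[of 1] *[of 2] *[of 3] *[of 4] assms by (simp_all add: d2q5_M_mult)
    then show ?thesis by (simp add: vec_eq_iff forall_5)
  qed
  then show ?thesis
    by (simp add: invertible_left_inverse matrix_left_invertible_ker)
qed

lemma diag5_mult: "(diag5 d *v v) $ i = d $ i * v $ i"
proof -
  have "(diag5 d *v v) $ i = (\<Sum>j\<in>UNIV. (if i = j then d $ i else 0) * v $ j)"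
    by (simp add: diag5_def matrix_vector_mult_def)
  also have "\<dots> = (\<Sum>j\<in>UNIV. if i = j then d $ i * v $ j else 0)"
    by (rule sum.cong) simp_all
  finally show ?thesis by simp
qed

lemma d2q5_S_mult:
  "(d2q5_S s1 s2 s4 s5 *v v) $ 0 = s1 * v $ 0"
  "(d2q5_S s1 s2 s4 s5 *v v) $ 1 = s2 * v $ 1"
  "(d2q5_S s1 s2 s4 s5 *v v) $ 2 = s2 * v $ 2"
  "(d2q5_S s1 s2 s4 s5 *v v) $ 3 = s4 * v $ 3"
  "(d2q5_S s1 s2 s4 s5 *v v) $ 4 = s5 * v $ 4"
  by (simp_all add: d2q5_S_def diag5_mult)

text \<open>
  The state of one node after collision and before streaming, so that an evolution merely
  transports these values to the neighbouring nodes.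
\<close>
definition mrt_post :: "real \<Rightarrow> real \<Rightarrow> real \<Rightarrow> real \<Rightarrow> real \<Rightarrow> real \<Rightarrow> real \<Rightarrow> real \<Rightarrow> real ^ 5 \<Rightarrow> real ^ 5"
  where
  "mrt_post c dt R w0 s1 s2 s4 s5 v =
     (let M = d2q5_M c; S = d2q5_S s1 s2 s4 s5; w = d2q5_weight w0
      in v - (matrix_inv M ** S ** M) *v (v - ((\<Sum>k\<in>UNIV. v $ k) + dt / 2 * R) *\<^sub>R w)
           + dt *\<^sub>R ((matrix_inv M ** (mat 1 - (1 / 2) *\<^sub>R S) ** M) *v (R *\<^sub>R w)))"

text \<open>
  Multiplying by \<open>M\<close> replaces the collision matrix by the diagonal \<open>S\<close>, so the explicit inverse of
  \<open>M\<close> never enters. Half of the source is absorbed into \<open>g\<close> and \<open>h\<close>: since the collision acts on the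
  source by \<open>I - S/2\<close>, this shift makes \<open>g\<close> relax as it would without a source, up to the constant
  \<open>\<Delta>t R w\<close>.
\<close>
lemma mrt_post_moments:
  fixes v :: "real ^ 5" and w0 dt R s1 s2 s4 s5 :: real
  assumes "c \<noteq> 0"
  defines "w \<equiv> d2q5_weight w0"
  defines "\<phi> \<equiv> (\<Sum>k\<in>UNIV. v $ k) + dt / 2 * R"
  defines "g \<equiv> v + (dt / 2 * R) *\<^sub>R w"
  defines "h \<equiv> mrt_post c dt R w0 s1 s2 s4 s5 v + (dt / 2 * R) *\<^sub>R w"
  defines "q \<equiv> \<phi> + dt * R - h $ 0"
  defines "p \<equiv> g $ 1 + g $ 3 - g $ 2 - g $ 4"
  shows "h $ 0 = (1 - s4) * g $ 0 + s4 * w0 * \<phi> + w0 * (dt * R)"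
    and "h $ 1 - h $ 3 = (1 - s2) * (g $ 1 - g $ 3)"
    and "h $ 2 - h $ 4 = (1 - s2) * (g $ 2 - g $ 4)"
    and "h $ 1 + h $ 3 = (q + (1 - s5) * p) / 2"
    and "h $ 2 + h $ 4 = (q - (1 - s5) * p) / 2"
proof -
  define M where "M = d2q5_M c"
  define S where "S = d2q5_S s1 s2 s4 s5"
  define P where "P = mrt_post c dt R w0 s1 s2 s4 s5 v"
  have inv: "M ** matrix_inv M = mat 1"
    using d2q5_M_invertible[OF assms(1)] unfolding invertible_def M_def[symmetric] matrix_inv_def
    by (rule someI_ex[THEN conjunct1])
  have cancel: "M *v ((matrix_inv M ** A ** M) *v x) = A *v (M *v x)" for A x
    by (metis inv matrix_mul_assoc matrix_mul_lid matrix_vector_mul_assoc)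
  have MP: "M *v P = M *v v - S *v (M *v (v - \<phi> *\<^sub>R w))
      + dt *\<^sub>R (M *v (R *\<^sub>R w) - (1 / 2) *\<^sub>R (S *v (M *v (R *\<^sub>R w))))"
    unfolding P_def mrt_post_def Let_def M_def[symmetric] S_def[symmetric] w_def[symmetric]
      \<phi>_def[symmetric]
    by (simp only: matrix_vector_mult_diff_distrib matrix_vector_right_distrib
        matrix_vector_mult_scaleR cancel matrix_vector_mult_diff_rdistrib
        matrix_vector_mul_lid scaleR_matrix_vector_assoc[symmetric])
      (simp add: scaleR_right_diff_distrib mult.commute)
  have mom: "(M *v P) $ k = (M *v v) $ k - (S *v (M *v (v - \<phi> *\<^sub>R w))) $ k
      + dt * ((M *v (R *\<^sub>R w)) $ k - (1 / 2) * (S *v (M *v (R *\<^sub>R w))) $ k)" for k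
    by (simp add: MP)
  have w: "w $ 0 = w0" "w $ 1 = (1 - w0) / 4" "w $ 2 = (1 - w0) / 4"
    "w $ 3 = (1 - w0) / 4" "w $ 4 = (1 - w0) / 4"
    by (simp_all add: w_def d2q5_weight_def)
  note eval = M_def S_def d2q5_M_mult d2q5_S_mult w
  have \<phi>: "\<phi> = v $ 0 + v $ 1 + v $ 2 + v $ 3 + v $ 4 + dt / 2 * R"
    by (simp add: \<phi>_def sum_5)
  have m0: "P $ 0 + P $ 1 + P $ 2 + P $ 3 + P $ 4 = \<phi> + dt / 2 * R"
    using mom[of 0] by (simp add: eval \<phi> field_simps)
  have m1: "P $ 1 - P $ 3 = (1 - s2) * (v $ 1 - v $ 3)"
  proof -
    have "c * (P $ 1 - P $ 3) = c * ((1 - s2) * (v $ 1 - v $ 3))"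
      using mom[of 1] by (simp add: eval algebra_simps)
    then show ?thesis using assms(1) by simp
  qed
  have m2: "P $ 2 - P $ 4 = (1 - s2) * (v $ 2 - v $ 4)"
  proof -
    have "c * (P $ 2 - P $ 4) = c * ((1 - s2) * (v $ 2 - v $ 4))"
      using mom[of 2] by (simp add: eval algebra_simps)
    then show ?thesis using assms(1) by simp
  qed
  have m3: "P $ 1 + P $ 2 + P $ 3 + P $ 4 - 4 * P $ 0
      = (1 - s4) * (v $ 1 + v $ 2 + v $ 3 + v $ 4 - 4 * v $ 0)
        + (s4 * \<phi> + dt * R * (1 - s4 / 2)) * (1 - 5 * w0)" (is "?l = ?r")
  proof -
    have "c\<^sup>2 * ?l = c\<^sup>2 * ?r"
      using mom[of 3] unfolding eval by (simp add: w field_simps)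
    then show ?thesis using assms(1) by simp
  qed
  have m4: "P $ 1 - P $ 2 + P $ 3 - P $ 4 = (1 - s5) * (v $ 1 - v $ 2 + v $ 3 - v $ 4)"
    (is "?l = ?r")
  proof -
    have "c\<^sup>2 * ?l = c\<^sup>2 * ?r"
      using mom[of 4] unfolding eval by (simp add: w algebra_simps)
    then show ?thesis using assms(1) by simp
  qed
  have h: "h $ k = P $ k + dt / 2 * R * w $ k" and g: "g $ k = v $ k + dt / 2 * R * w $ k" for k
    by (simp_all add: h_def g_def P_def)
  \<comment> \<open>Total mass minus the energy moment isolates the rest population.\<close>
  have P0: "5 * P $ 0 = \<phi> + dt / 2 * R - ((1 - s4) * (\<phi> - dt / 2 * R - 5 * v $ 0)
        + (s4 * \<phi> + dt * R * (1 - s4 / 2)) * (1 - 5 * w0))"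
    using m0 m3 \<phi> by (simp add: algebra_simps)
  have "5 * h $ 0 = 5 * ((1 - s4) * g $ 0 + s4 * w0 * \<phi> + w0 * (dt * R))"
    unfolding h g w distrib_left P0 by (simp add: field_simps)
  then show "h $ 0 = (1 - s4) * g $ 0 + s4 * w0 * \<phi> + w0 * (dt * R)" by simp
  show "h $ 1 - h $ 3 = (1 - s2) * (g $ 1 - g $ 3)" "h $ 2 - h $ 4 = (1 - s2) * (g $ 2 - g $ 4)"
    using m1 m2 by (simp_all add: h g w)
  have p: "p = v $ 1 - v $ 2 + v $ 3 - v $ 4"
    by (simp add: p_def g w)
  have hsum: "h $ 1 + h $ 3 + (h $ 2 + h $ 4) = q"
    using m0 by (simp add: q_def h w field_simps)
  have hdiff: "h $ 1 + h $ 3 - (h $ 2 + h $ 4) = (1 - s5) * p"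
    unfolding p m4[symmetric] by (simp add: h w)
  show "h $ 1 + h $ 3 = (q + (1 - s5) * p) / 2" "h $ 2 + h $ 4 = (q - (1 - s5) * p) / 2"
    using hsum hdiff by simp_all
qed

section \<open>Streaming\<close>

lemma mrt_lb_evolution_step:
  assumes "mrt_lb_evolution dx dt R w0 s1 s2 s4 s5 f" and "r \<in> lattice_points dx"
  shows "f (r + dt *\<^sub>R (d2q5_velocity (dx / dt) $ k)) (real (Suc n) * dt) $ k
    = mrt_post (dx / dt) dt R w0 s1 s2 s4 s5 (f r (real n * dt)) $ k"
proof -
  have "real (Suc n) * dt = real n * dt + dt" by (simp add: algebra_simps)
  then show ?thesis
    using assms unfolding mrt_lb_evolution_def mrt_post_def Let_def macro_def
    by (simp add: matrix_vector_mult_def)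
qed

text \<open>
  The post-collision values \<open>u'\<close> and \<open>v'\<close> move one step right and left. Hence \<open>s\<close> at the next time
  feels the momentum \<open>u - v\<close> only through its discrete divergence, and by streaming this divergence
  is already expressible by \<open>s\<close> and the earlier total \<open>e\<close>; this is why one more time level closes
  the recursion for \<open>s\<close>.
\<close>
lemma opposite_pair:
  fixes u v u' v' :: "nat \<Rightarrow> int \<Rightarrow> real"
  assumes stream: "\<And>n i. u (Suc n) i = u' n (i - 1)" "\<And>n i. v (Suc n) i = v' n (i + 1)"
    and flux: "\<And>n i. u' n i - v' n i = a * (u n i - v n i)"
    and total: "\<And>n i. u' n i + v' n i = e n i"
    and s: "\<And>n i. s n i = u n i + v n i"
  shows "s (n + 2) i = (e (n + 1) (i - 1) + e (n + 1) (i + 1)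
           + a * (s (n + 1) (i - 1) + s (n + 1) (i + 1))) / 2 - a * e n i"
proof -
  have post: "2 * u' n i = e n i + a * (u n i - v n i)" "2 * v' n i = e n i - a * (u n i - v n i)"
    for n i
    by (simp_all flip: flux total)
  have flux_div: "(u (Suc n) (i - 1) - v (Suc n) (i - 1)) - (u (Suc n) (i + 1) - v (Suc n) (i + 1))
      = s (Suc n) (i - 1) + s (Suc n) (i + 1) - 2 * e n i"
    by (simp add: s stream flip: total)
  have "2 * s (n + 2) i = 2 * u' (Suc n) (i - 1) + 2 * v' (Suc n) (i + 1)"
    by (simp add: s stream)
  also have "\<dots> = e (Suc n) (i - 1) + e (Suc n) (i + 1)
      + a * ((u (Suc n) (i - 1) - v (Suc n) (i - 1)) - (u (Suc n) (i + 1) - v (Suc n) (i + 1)))"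
    unfolding post by (simp add: algebra_simps)
  finally show ?thesis unfolding flux_div by (simp add: field_simps)
qed

section \<open>Elimination of the non-conserved moments\<close>

text \<open>
  The recursions along the two axes form a linear system with coefficients in the commutative ring
  of shifts. Cross-multiplying by the coefficients of \<open>p\<close>, which are
  \<open>z\<^sup>2 - (a + b) z E / 2 + a b\<close> with \<open>E = E\<^sub>x\<close> or \<open>E = E\<^sub>y\<close>, makes \<open>p\<close> cancel.
\<close>
lemma eliminate_anisotropy:
  fixes \<sigma> p q :: "nat \<Rightarrow> int \<Rightarrow> int \<Rightarrow> real" and a b :: real
  defines "sx \<equiv> \<lambda>n i j. (\<sigma> n i j + p n i j) / 2" and "sy \<equiv> \<lambda>n i j. (\<sigma> n i j - p n i j) / 2"
    and "ex \<equiv> \<lambda>n i j. (q n i j + b * p n i j) / 2" and "ey \<equiv> \<lambda>n i j. (q n i j - b * p n i j) / 2"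
  assumes x: "\<And>n i j. sx (n + 2) i j = (ex (n + 1) (i - 1) j + ex (n + 1) (i + 1) j
           + a * (sx (n + 1) (i - 1) j + sx (n + 1) (i + 1) j)) / 2 - a * ex n i j"
    and y: "\<And>n i j. sy (n + 2) i j = (ey (n + 1) i (j - 1) + ey (n + 1) i (j + 1)
           + a * (sy (n + 1) i (j - 1) + sy (n + 1) i (j + 1))) / 2 - a * ey n i j"
  shows "4 * \<sigma> (n + 4) i j =
      (2 * a + b) * Sigma1 (\<sigma> (n + 3)) i j - 4 * a * b * \<sigma> (n + 2) i j
      - a * (a + b) * Sigma2 (\<sigma> (n + 2)) i j + a\<^sup>2 * b * Sigma1 (\<sigma> (n + 1)) i j
      + Sigma1 (q (n + 3)) i j - 4 * a * q (n + 2) i j - (a + b) * Sigma2 (q (n + 2)) i j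
      + a * (a + 2 * b) * Sigma1 (q (n + 1)) i j - 4 * a\<^sup>2 * b * q n i j"
proof -
  define X where "X n i j = sx (n + 2) i j - ((ex (n + 1) (i - 1) j + ex (n + 1) (i + 1) j
           + a * (sx (n + 1) (i - 1) j + sx (n + 1) (i + 1) j)) / 2 - a * ex n i j)" for n i j
  define Y where "Y n i j = sy (n + 2) i j - ((ey (n + 1) i (j - 1) + ey (n + 1) i (j + 1)
           + a * (sy (n + 1) i (j - 1) + sy (n + 1) i (j + 1))) / 2 - a * ey n i j)" for n i j
  have XY: "X n i j = 0" "Y n i j = 0" for n i j
    unfolding X_def Y_def x y by simp_all
  have times: "n + 2 + 2 = n + 4" "n + 2 + 1 = n + 3" "n + 1 + 2 = n + 3" "n + 1 + 1 = n + 2"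
    by simp_all
  \<comment> \<open>The residuals are combined with the cross-multipliers; the factor 4 clears denominators.\<close>
  have "4 * \<sigma> (n + 4) i j -
      ((2 * a + b) * Sigma1 (\<sigma> (n + 3)) i j - 4 * a * b * \<sigma> (n + 2) i j
      - a * (a + b) * Sigma2 (\<sigma> (n + 2)) i j + a\<^sup>2 * b * Sigma1 (\<sigma> (n + 1)) i j
      + Sigma1 (q (n + 3)) i j - 4 * a * q (n + 2) i j - (a + b) * Sigma2 (q (n + 2)) i j
      + a * (a + 2 * b) * Sigma1 (q (n + 1)) i j - 4 * a\<^sup>2 * b * q n i j)
    = 4 * (X (n + 2) i j + Y (n + 2) i j)
      - 2 * (a + b) * (X (n + 1) i (j - 1) + X (n + 1) i (j + 1)
                   + Y (n + 1) (i - 1) j + Y (n + 1) (i + 1) j)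
      + 4 * a * b * (X n i j + Y n i j)"
    unfolding X_def Y_def sx_def sy_def ex_def ey_def Sigma1_def Sigma2_def times
    by (simp add: field_simps power2_eq_square)
  then show ?thesis by (simp add: XY)
qed

text \<open>
  The coefficients of \<open>four\<close> are constant in time, so the operator \<open>z - d\<close> passes through them and
  acts on \<open>\<sigma>\<close> and \<open>q\<close> alone, where it annihilates the homogeneous part of \<open>g\<close>. The constant \<open>G\<close>
  drops out of the conclusion because it contributes equally to \<open>\<sigma>\<close> and \<open>q\<close>, and on constant
  fields \<open>four\<close> reduces to \<open>\<sigma> = q\<close> times \<open>4 (1 - a)\<^sup>2 (1 - b)\<close>; the same factor multiplies the
  surviving source \<open>(1 - d) F\<close>.
\<close>
lemma eliminate_rest_population:
  fixes \<phi> g :: "nat \<Rightarrow> int \<Rightarrow> int \<Rightarrow> real" and a b d k F G :: real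
  defines "\<sigma> \<equiv> \<lambda>n i j. \<phi> n i j - g n i j"
    and "q \<equiv> \<lambda>n i j. \<phi> n i j + F - g (Suc n) i j"
  assumes g: "\<And>n i j. g (Suc n) i j = d * g n i j + k * \<phi> n i j + G"
    and four: "\<And>n i j. 4 * \<sigma> (n + 4) i j =
      (2 * a + b) * Sigma1 (\<sigma> (n + 3)) i j - 4 * a * b * \<sigma> (n + 2) i j
      - a * (a + b) * Sigma2 (\<sigma> (n + 2)) i j + a\<^sup>2 * b * Sigma1 (\<sigma> (n + 1)) i j
      + Sigma1 (q (n + 3)) i j - 4 * a * q (n + 2) i j - (a + b) * Sigma2 (q (n + 2)) i j
      + a * (a + 2 * b) * Sigma1 (q (n + 1)) i j - 4 * a\<^sup>2 * b * q n i j"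
  shows "4 * \<phi> (n + 5) i j =
      4 * (d + k) * \<phi> (n + 4) i j + (2 * a + b + 1 - k) * Sigma1 (\<phi> (n + 4)) i j
      - 4 * a * (b + 1 - k) * \<phi> (n + 3) i j
      - ((2 * a + b + 1) * d + (2 * a + b) * k) * Sigma1 (\<phi> (n + 3)) i j
      - (a + b) * (a + 1 - k) * Sigma2 (\<phi> (n + 3)) i j
      + 4 * a * (b * (d + k) + d) * \<phi> (n + 2) i j
      + a * (a * b + (a + 2 * b) * (1 - k)) * Sigma1 (\<phi> (n + 2)) i j
      + (a + b) * (a * (d + k) + d) * Sigma2 (\<phi> (n + 2)) i j
      - 4 * a\<^sup>2 * b * (1 - k) * \<phi> (n + 1) i j
      - a * (a * b * (d + k) + (a + 2 * b) * d) * Sigma1 (\<phi> (n + 1)) i j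
      + 4 * a\<^sup>2 * b * d * \<phi> n i j
      + 4 * (1 - a)\<^sup>2 * (1 - b) * (1 - d) * F"
proof -
  have \<sigma>: "\<sigma> (Suc n) i j - d * \<sigma> n i j = \<phi> (Suc n) i j - (d + k) * \<phi> n i j - G"
    and q: "q (Suc n) i j - d * q n i j
      = (1 - k) * \<phi> (Suc n) i j - d * \<phi> n i j + (1 - d) * F - G" for n i j
    by (simp_all add: \<sigma>_def q_def g[of "Suc n"] g[of n] algebra_simps)
  have \<sigma>1: "Sigma1 (\<sigma> (Suc n)) i j - d * Sigma1 (\<sigma> n) i j
      = Sigma1 (\<phi> (Suc n)) i j - (d + k) * Sigma1 (\<phi> n) i j - 4 * G"
    and \<sigma>2: "Sigma2 (\<sigma> (Suc n)) i j - d * Sigma2 (\<sigma> n) i j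
      = Sigma2 (\<phi> (Suc n)) i j - (d + k) * Sigma2 (\<phi> n) i j - 4 * G"
    and q1: "Sigma1 (q (Suc n)) i j - d * Sigma1 (q n) i j
      = (1 - k) * Sigma1 (\<phi> (Suc n)) i j - d * Sigma1 (\<phi> n) i j + 4 * ((1 - d) * F - G)"
    and q2: "Sigma2 (q (Suc n)) i j - d * Sigma2 (q n) i j
      = (1 - k) * Sigma2 (\<phi> (Suc n)) i j - d * Sigma2 (\<phi> n) i j + 4 * ((1 - d) * F - G)"
    for n i j
    using \<sigma>[of n "i - 1" j] \<sigma>[of n "i + 1" j] \<sigma>[of n i "j - 1"] \<sigma>[of n i "j + 1"]
      \<sigma>[of n "i - 1" "j - 1"] \<sigma>[of n "i - 1" "j + 1"] \<sigma>[of n "i + 1" "j - 1"]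
      \<sigma>[of n "i + 1" "j + 1"]
      q[of n "i - 1" j] q[of n "i + 1" j] q[of n i "j - 1"] q[of n i "j + 1"]
      q[of n "i - 1" "j - 1"] q[of n "i - 1" "j + 1"] q[of n "i + 1" "j - 1"]
      q[of n "i + 1" "j + 1"]
    by (simp_all add: Sigma1_def Sigma2_def distrib_left)
  have "4 * (\<sigma> (Suc (n + 4)) i j - d * \<sigma> (n + 4) i j)
    = 4 * \<sigma> (Suc n + 4) i j - d * (4 * \<sigma> (n + 4) i j)"
    by simp
  also have "\<dots> =
      (2 * a + b) * (Sigma1 (\<sigma> (Suc (n + 3))) i j - d * Sigma1 (\<sigma> (n + 3)) i j)
      - 4 * a * b * (\<sigma> (Suc (n + 2)) i j - d * \<sigma> (n + 2) i j)
      - a * (a + b) * (Sigma2 (\<sigma> (Suc (n + 2))) i j - d * Sigma2 (\<sigma> (n + 2)) i j)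
      + a\<^sup>2 * b * (Sigma1 (\<sigma> (Suc (n + 1))) i j - d * Sigma1 (\<sigma> (n + 1)) i j)
      + (Sigma1 (q (Suc (n + 3))) i j - d * Sigma1 (q (n + 3)) i j)
      - 4 * a * (q (Suc (n + 2)) i j - d * q (n + 2) i j)
      - (a + b) * (Sigma2 (q (Suc (n + 2))) i j - d * Sigma2 (q (n + 2)) i j)
      + a * (a + 2 * b) * (Sigma1 (q (Suc (n + 1))) i j - d * Sigma1 (q (n + 1)) i j)
      - 4 * a\<^sup>2 * b * (q (Suc n) i j - d * q n i j)"
    unfolding four unfolding add_Suc by (simp add: algebra_simps)
  finally show ?thesis
    unfolding \<sigma> q \<sigma>1 \<sigma>2 q1 q2
    by (simp add: eval_nat_numeral) algebra
qed

section \<open>The six-level finite-difference scheme\<close>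

theorem mainTheorem2:
  fixes dx dt R w0 s1 s2 s4 s5 :: real
    and f :: "real \<times> real \<Rightarrow> real \<Rightarrow> real ^ 5"
  assumes "dx > 0" and "dt > 0"
    and "w0 \<in> {0<..<1}"
    and "s1 \<in> {0<..<2}" and "s2 \<in> {0<..<2}" and "s4 \<in> {0<..<2}" and "s5 \<in> {0<..<2}"
    and "mrt_lb_evolution dx dt R w0 s1 s2 s4 s5 f"
  shows
    "let \<phi> = macro_grid dx dt R f;
         \<alpha>1 = (w0 - 1) * s4 + 1;
         \<alpha>2 = 1 - s5 / 4 - s2 / 2 - s4 * w0 / 4;
         \<beta>1 = (s4 * w0 + s5 - 2) * (1 - s2);
         \<beta>2 = ((s5 + 2 * s2 - 4) * (1 - s4) + w0 * s4 * (s5 + 2 * s2 - 3)) / 4;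
         \<beta>3 = ((2 - s2 - s4 * w0) * (s2 + s5 - 2)) / 4;
         \<gamma>1 = s4 * w0 * (s2 - 1) * (s5 - 1) + (1 - s4) * (s5 - 2) * (s2 - 1);
         \<gamma>2 = ((s2 - 1) * (s4 * w0 * (3 - s2 - 2 * s5) + (2 * s2 + 3 * s5 - s2 * s5 - 4))) / 4;
         \<gamma>3 = (w0 * s4 * (s2 - 1) * (s2 + s5 - 2) + (1 - s4) * (s2 - 2) * (s2 + s5 - 2)) / 4;
         \<zeta>1 = (w0 * s4 - 1) * (1 - s5) * (s2 - 1)\<^sup>2;
         \<zeta>2 = (s4 * w0 * (s2 - 1)\<^sup>2 * (s5 - 1)
               + (1 - s4) * (1 - s2) * (2 * s2 + 3 * s5 - s2 * s5 - 4)) / 4;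
         \<eta> = (1 - s2)\<^sup>2 * (1 - s4) * (1 - s5);
         \<delta> = s2\<^sup>2 * s4 * s5
     in \<forall>n \<ge> 4. \<forall>i j.
          \<phi> (n + 1) i j =
            \<alpha>1 * \<phi> n i j + \<alpha>2 * Sigma1 (\<phi> n) i j
            + \<beta>1 * \<phi> (n - 1) i j + \<beta>2 * Sigma1 (\<phi> (n - 1)) i j + \<beta>3 * Sigma2 (\<phi> (n - 1)) i j
            + \<gamma>1 * \<phi> (n - 2) i j + \<gamma>2 * Sigma1 (\<phi> (n - 2)) i j + \<gamma>3 * Sigma2 (\<phi> (n - 2)) i j
            + \<zeta>1 * \<phi> (n - 3) i j + \<zeta>2 * Sigma1 (\<phi> (n - 3)) i j
            + \<eta> * \<phi> (n - 4) i j + dt * \<delta> * R"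
proof -
  define w where "w = d2q5_weight w0"
  define c where "c = dx / dt"
  define r where "r i j = (of_int i * dx, of_int j * dx)" for i j :: int
  define g where "g n i j k = f (r i j) (real n * dt) $ k + dt / 2 * R * w $ k" for n i j k
  define h where "h n i j k = mrt_post c dt R w0 s1 s2 s4 s5 (f (r i j) (real n * dt)) $ k
      + dt / 2 * R * w $ k" for n i j k
  define \<phi> where "\<phi> = macro_grid dx dt R f"
  define p where "p n i j = g n i j 1 + g n i j 3 - g n i j 2 - g n i j 4" for n i j
  define q where "q n i j = \<phi> n i j + dt * R - h n i j 0" for n i j
  define a where "a = 1 - s2"
  define b where "b = 1 - s5"
  have c0: "c \<noteq> 0" and dt0: "dt \<noteq> 0"
    using assms(1,2) by (simp_all add: c_def)
  have \<phi>_v: "\<phi> n i j = (\<Sum>k\<in>UNIV. f (r i j) (real n * dt) $ k) + dt / 2 * R" for n i j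
    by (simp add: \<phi>_def macro_grid_def macro_def r_def)
  have \<phi>_g: "\<phi> n i j = g n i j 0 + g n i j 1 + g n i j 2 + g n i j 3 + g n i j 4" for n i j
    by (simp add: \<phi>_v g_def sum_5 w_def d2q5_weight_def field_simps)

  have coll: "h n i j 0 = (1 - s4) * g n i j 0 + s4 * w0 * \<phi> n i j + w0 * (dt * R)"
    "h n i j 1 - h n i j 3 = a * (g n i j 1 - g n i j 3)"
    "h n i j 2 - h n i j 4 = a * (g n i j 2 - g n i j 4)"
    "h n i j 1 + h n i j 3 = (q n i j + b * p n i j) / 2"
    "h n i j 2 + h n i j 4 = (q n i j - b * p n i j) / 2" for n i j
    using mrt_post_moments[OF c0, of dt R w0 s1 s2 s4 s5 "f (r i j) (real n * dt)"]
    by (simp_all add: h_def g_def \<phi>_v w_def a_def b_def p_def q_def)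

  have step: "f (r i j + dt *\<^sub>R (d2q5_velocity c $ k)) (real (Suc n) * dt) $ k + dt / 2 * R * w $ k
      = h n i j k" for n i j k
  proof -
    have "r i j \<in> lattice_points dx" by (auto simp: lattice_points_def r_def)
    from mrt_lb_evolution_step[OF assms(8) this, of k n] show ?thesis
      by (simp add: h_def c_def)
  qed
  have shift: "r i j + dt *\<^sub>R (d2q5_velocity c $ 0) = r i j"
    "r (i - 1) j + dt *\<^sub>R (d2q5_velocity c $ 1) = r i j"
    "r i (j - 1) + dt *\<^sub>R (d2q5_velocity c $ 2) = r i j"
    "r (i + 1) j + dt *\<^sub>R (d2q5_velocity c $ 3) = r i j"
    "r i (j + 1) + dt *\<^sub>R (d2q5_velocity c $ 4) = r i j" for i j
    using dt0 by (simp_all add: r_def d2q5_velocity_def c_def algebra_simps)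
  have stream: "g (Suc n) i j 0 = h n i j 0"
    "g (Suc n) i j 1 = h n (i - 1) j 1" "g (Suc n) i j 3 = h n (i + 1) j 3"
    "g (Suc n) i j 2 = h n i (j - 1) 2" "g (Suc n) i j 4 = h n i (j + 1) 4" for n i j
    unfolding g_def
    using step[of i j 0 n] step[of "i - 1" j 1 n] step[of "i + 1" j 3 n]
      step[of i "j - 1" 2 n] step[of i "j + 1" 4 n]
    unfolding shift by simp_all

  define \<sigma> where "\<sigma> n i j = \<phi> n i j - g n i j 0" for n i j
  have sx: "(\<sigma> n i j + p n i j) / 2 = g n i j 1 + g n i j 3"
    and sy: "(\<sigma> n i j - p n i j) / 2 = g n i j 2 + g n i j 4" for n i j
    by (simp_all add: \<sigma>_def \<phi>_g p_def)
  have q: "q n i j = \<phi> n i j + dt * R - g (Suc n) i j 0" for n i j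
    by (simp add: q_def stream)
  have g0: "g (Suc n) i j 0 = (1 - s4) * g n i j 0 + s4 * w0 * \<phi> n i j + w0 * (dt * R)" for n i j
    by (simp add: stream coll)
  note four = eliminate_anisotropy[of \<sigma> p q b a,
      OF opposite_pair[of "\<lambda>n i. g n i _ 1" "\<lambda>n i. h n i _ 1" "\<lambda>n i. g n i _ 3" "\<lambda>n i. h n i _ 3",
           OF stream(2,3) coll(2,4) sx]
         opposite_pair[of "\<lambda>n j. g n _ j 2" "\<lambda>n j. h n _ j 2" "\<lambda>n j. g n _ j 4" "\<lambda>n j. h n _ j 4",
           OF stream(4,5) coll(3,5) sy]]
  note six = eliminate_rest_population[of "\<lambda>n i j. g n i j 0", OF g0 four[unfolded \<sigma>_def q]]
  show ?thesis
    unfolding Let_def \<phi>_def[symmetric]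
  proof (intro allI impI, goal_cases)
    case (1 n i j)
    then obtain m where n: "n = m + 4" by (metis le_add_diff_inverse2)
    have times: "m + 4 + 1 = m + 5" "m + 4 - 1 = m + 3" "m + 4 - 2 = m + 2" "m + 4 - 3 = m + 1"
      "m + 4 - 4 = m" by simp_all
    show ?case
      unfolding n times using six[of m i j] unfolding a_def b_def by algebra
  qed
qed

end
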